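(* Let $\Gamma$ be a finite dismantlable graph and let $Y=\Gamma^{\blacktriangle}$ be the flag simplicial complex spanned on $\Gamma$. Let $H$ be a finite subgroup of $\mathrm{Aut}(Y)$. Then the set $Y^H$ of points of $Y$ fixed by $H$ is contractible.
   Context: Graphs are simple (no loops or double edges). For a vertex $\rho$ of a graph, its neighbourhood $N(\rho)$ is the set consisting of $\rho$ and all vertices adjacent to $\rho$. A vertex $\rho$ is dominated by a vertex $\pi\neq\rho$ if $N(\rho)\subset N(\pi)$ (equality allowed). A finite graph is dismantlable if its vertices can be ordered into a sequence $\sigma_1,\dots,\sigma_m$ such that for each $i<m$ the vertex $\sigma_i$ is dominated (by some other vertex) in the subgraph induced on $\{\sigma_i,\dots,\sigma_m\}$. $\Gamma^{\blacktriangle}$ denotes the simplicial complex with $1$-skeleton $\Gamma$ whose simplices are spanned on all cliques of $\Gamma$. $\mathrm{Aut}(Y)$ is the group of simplicial automorphisms, acting on the geometric realisation of $Y$ (affinely on simplices); $Y^H$ is the fixed point set in the geometric realisation. *)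

theory Defs
  imports
    "Graph_Theory.Digraph_Component"
    "HOL-Algebra.Bij"
    "HOL-Analysis.Analysis"
begin

section \<open>Dismantlable graphs\<close>

text \<open>
  A finite simple graph is a \<^locale>\<open>graph\<close> in the sense of Graph_Theory: a finite, loop-free,
  symmetric digraph without parallel arcs. The relation written \<open>u \<rightarrow>\<^bsub>G\<^esub> v\<close> there (and called
  \<open>dominates\<close>) is adjacency; it has nothing to do with domination in the sense below.
\<close>

definition neighbourhood :: "('a, 'b) pre_digraph \<Rightarrow> 'a \<Rightarrow> 'a set" where
  "neighbourhood G \<rho> = insert \<rho> {v. \<rho> \<rightarrow>\<^bsub>G\<^esub> v}"

definition dominated_by :: "('a, 'b) pre_digraph \<Rightarrow> 'a \<Rightarrow> 'a \<Rightarrow> bool" where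
  "dominated_by G \<rho> \<pi> \<longleftrightarrow>
     \<rho> \<in> verts G \<and> \<pi> \<in> verts G \<and> \<pi> \<noteq> \<rho> \<and> neighbourhood G \<rho> \<subseteq> neighbourhood G \<pi>"

text \<open>
  The sequence is indexed from 0, so \<open>drop i \<sigma>\<close> lists the vertex \<open>\<sigma> ! i\<close> and all later ones. It is
  required to be nonempty: the empty graph does not count as dismantlable.
\<close>

definition dismantlable :: "('a, 'b) pre_digraph \<Rightarrow> bool" where
  "dismantlable G \<longleftrightarrow>
     (\<exists>\<sigma>. \<sigma> \<noteq> [] \<and> distinct \<sigma> \<and> set \<sigma> = verts G \<and>
        (\<forall>i. Suc i < length \<sigma> \<longrightarrow>
           (\<exists>\<pi>. dominated_by (G \<restriction> set (drop i \<sigma>)) (\<sigma> ! i) \<pi>)))"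


section \<open>Simplicial complexes and their automorphisms\<close>

text \<open>
  A simplicial complex is given by its set of simplices, a simplex being identified with its
  finite nonempty set of vertices; the vertex set of \<open>K\<close> is \<open>\<Union>K\<close>.
\<close>

definition clique :: "('a, 'b) pre_digraph \<Rightarrow> 'a set \<Rightarrow> bool" where
  "clique G C \<longleftrightarrow> C \<subseteq> verts G \<and> (\<forall>u\<in>C. \<forall>v\<in>C. u \<noteq> v \<longrightarrow> u \<rightarrow>\<^bsub>G\<^esub> v)"

definition flag_complex :: "('a, 'b) pre_digraph \<Rightarrow> 'a set set" where
  "flag_complex G = {s. finite s \<and> s \<noteq> {} \<and> clique G s}"

definition simplicial_map :: "'a set set \<Rightarrow> 'b set set \<Rightarrow> ('a \<Rightarrow> 'b) \<Rightarrow> bool" where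
  "simplicial_map K L f \<longleftrightarrow> (\<forall>s\<in>K. f ` s \<in> L)"

definition simplicial_automorphisms :: "'a set set \<Rightarrow> ('a \<Rightarrow> 'a) set" where
  "simplicial_automorphisms K =
     {f \<in> Bij (\<Union>K). simplicial_map K K f \<and> simplicial_map K K (inv_into (\<Union>K) f)}"

definition Aut :: "'a set set \<Rightarrow> ('a \<Rightarrow> 'a) monoid" where
  "Aut K = BijGroup (\<Union>K) \<lparr>carrier := simplicial_automorphisms K\<rparr>"

lemma subgroup_simplicial_automorphisms:
  "subgroup (simplicial_automorphisms K) (BijGroup (\<Union>K))"
proof (rule subgroup.intro)
  show "simplicial_automorphisms K \<subseteq> carrier (BijGroup (\<Union>K))"
    by (auto simp: simplicial_automorphisms_def BijGroup_def)
next
  have "(\<lambda>x\<in>\<Union>K. x) ` s = s" if "s \<in> K" for s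
    using that by auto
  moreover have "inv_into (\<Union>K) (\<lambda>x\<in>\<Union>K. x) ` s = s" if "s \<in> K" for s
  proof -
    have "inv_into (\<Union>K) (\<lambda>x\<in>\<Union>K. x) x = x" if "x \<in> \<Union>K" for x
      using that by (intro inv_into_f_eq) (auto simp: inj_on_def)
    then show ?thesis using that by force
  qed
  ultimately show "\<one>\<^bsub>BijGroup (\<Union>K)\<^esub> \<in> simplicial_automorphisms K"
    by (simp add: simplicial_automorphisms_def BijGroup_def id_Bij simplicial_map_def)
next
  fix f g assume f: "f \<in> simplicial_automorphisms K" and g: "g \<in> simplicial_automorphisms K"
  then have B: "f \<in> Bij (\<Union>K)" "g \<in> Bij (\<Union>K)"
    by (auto simp: simplicial_automorphisms_def)
  have bij: "bij_betw f (\<Union>K) (\<Union>K)" "bij_betw g (\<Union>K) (\<Union>K)"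
    using B by (auto simp: Bij_def)
  have "compose (\<Union>K) f g ` s = f ` g ` s" if "s \<in> K" for s
    unfolding image_image by (rule image_cong) (use that in \<open>auto simp: compose_def\<close>)
  moreover have "inv_into (\<Union>K) (compose (\<Union>K) f g) ` s
      = inv_into (\<Union>K) g ` inv_into (\<Union>K) f ` s" if "s \<in> K" for s
  proof -
    have "inv_into (\<Union>K) (compose (\<Union>K) f g) x = inv_into (\<Union>K) g (inv_into (\<Union>K) f x)"
      if x: "x \<in> \<Union>K" for x
    proof (rule inv_into_f_eq)
      show "inj_on (compose (\<Union>K) f g) (\<Union>K)"
        using compose_Bij[OF B] by (auto simp: Bij_def bij_betw_def)
      have y: "inv_into (\<Union>K) f x \<in> \<Union>K"
        using B(1) x by (rule Bij_inv_into_mem)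
      show z: "inv_into (\<Union>K) g (inv_into (\<Union>K) f x) \<in> \<Union>K"
        using B(2) y by (rule Bij_inv_into_mem)
      show "compose (\<Union>K) f g (inv_into (\<Union>K) g (inv_into (\<Union>K) f x)) = x"
        using bij_betw_inv_into_right[OF bij(2) y] bij_betw_inv_into_right[OF bij(1) x] z
        by (simp only: compose_eq)
    qed
    then show ?thesis unfolding image_image by (intro image_cong) (use that in auto)
  qed
  ultimately show "f \<otimes>\<^bsub>BijGroup (\<Union>K)\<^esub> g \<in> simplicial_automorphisms K"
    using f g B compose_Bij[OF B]
    by (simp add: BijGroup_def simplicial_automorphisms_def simplicial_map_def)
next
  fix f assume f: "f \<in> simplicial_automorphisms K"
  then have B: "f \<in> Bij (\<Union>K)"
    by (auto simp: simplicial_automorphisms_def)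
  let ?g = "\<lambda>x\<in>\<Union>K. inv_into (\<Union>K) f x"
  have gB: "?g \<in> Bij (\<Union>K)" by (rule restrict_inv_into_Bij[OF B])
  have 1: "?g ` s = inv_into (\<Union>K) f ` s" if "s \<in> K" for s
    using that by (intro image_cong) auto
  have 2: "inv_into (\<Union>K) ?g ` s = f ` s" if s: "s \<in> K" for s
  proof (rule image_cong)
    fix x assume "x \<in> s"
    with s have x: "x \<in> \<Union>K" by auto
    have fx: "f x \<in> \<Union>K" using B x by (auto simp: Bij_def bij_betw_def)
    show "inv_into (\<Union>K) ?g x = f x"
    proof (rule inv_into_f_eq)
      show "inj_on ?g (\<Union>K)" using gB by (simp add: Bij_def bij_betw_def)
      show "f x \<in> \<Union>K" by (rule fx)
      have "inv_into (\<Union>K) f (f x) = x"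
        using B x by (intro inv_into_f_f) (auto simp: Bij_def bij_betw_def)
      then show "?g (f x) = x" using fx by (simp only: restrict_apply if_True)
    qed
  qed simp
  show "inv\<^bsub>BijGroup (\<Union>K)\<^esub> f \<in> simplicial_automorphisms K"
    using f gB 1 2
    by (simp add: inv_BijGroup[OF B] simplicial_automorphisms_def simplicial_map_def del: restrict_apply)
qed

lemma group_Aut: "group (Aut K)"
  unfolding Aut_def
  by (rule subgroup.subgroup_is_group[OF subgroup_simplicial_automorphisms group_BijGroup])


section \<open>Geometric realisation and fixed points\<close>

text \<open>
  A point of the realisation is its function of barycentric coordinates, extended by zero. The
  topology is the one induced from the product topology on \<^typ>\<open>'a \<Rightarrow> real\<close>. On a finite complex
  this is the usual topology of the realisation; on infinite complexes it would be coarser than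
  the weak topology.
\<close>

definition realisation :: "'a set set \<Rightarrow> ('a \<Rightarrow> real) set" where
  "realisation K =
     {x. (\<forall>v. 0 \<le> x v) \<and> {v. x v \<noteq> 0} \<in> K \<and> (\<Sum>v | x v \<noteq> 0. x v) = 1}"

text \<open>
  The map induced by a vertex map \<open>f\<close> is affine on each simplex and sends the vertex \<open>v\<close> to
  \<open>f v\<close>: it takes \<open>\<Sum>v. x v *\<^sub>R v\<close> to \<open>\<Sum>v. x v *\<^sub>R f v\<close>.
\<close>

definition realisation_map :: "('a \<Rightarrow> 'b) \<Rightarrow> ('a \<Rightarrow> real) \<Rightarrow> ('b \<Rightarrow> real)" where
  "realisation_map f x = (\<lambda>w. \<Sum>v | x v \<noteq> 0 \<and> f v = w. x v)"

definition fixed_points :: "'a set set \<Rightarrow> ('a \<Rightarrow> 'a) set \<Rightarrow> ('a \<Rightarrow> real) set" where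
  "fixed_points K H = {x \<in> realisation K. \<forall>h\<in>H. realisation_map h x = x}"

end

theory Submission
  imports Defs
begin

text \<open>
  Order the vertices of a finite graph by inclusion of closed neighbourhoods, and let \<open>M\<close> be the
  set of vertices whose neighbourhood is maximal. Send a vertex \<open>u\<close> to the barycentre of the set
  \<open>D u\<close> of all vertices of \<open>M\<close> above it. If \<open>u\<close> and \<open>v\<close> are adjacent or equal, then \<open>u\<close>
  and all of \<open>D u\<close> are adjacent or equal to \<open>v\<close> and all of \<open>D v\<close> (lemma \<open>dominators_adjacent\<close>). So a clique stays
  a clique when all these sets are added to it, and the affine extension of \<open>u \<mapsto> barycentre (D u)\<close>
  moves every point of the realisation within a single simplex. No choices were made, so this
  extension commutes with all automorphisms, and the straight line from a point fixed by \<open>H\<close> to its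
  image consists of points fixed by \<open>H\<close>. Hence the identity of the fixed point set is homotopic to a
  map into the fixed point set of the full subcomplex on \<open>M\<close>, and one can induct on the number of
  vertices.

  The induction stops when every vertex is maximal, and then the complex has to be shown to be a
  single simplex. Here dismantlability enters, in a form that passes from the graph to \<open>M\<close> without
  regard to any symmetry: the identity can be deformed to a constant map through vertex maps
  \<open>f\<^sub>0, f\<^sub>1, \<dots>\<close> such that \<open>f\<^sub>i u\<close> is adjacent or equal to \<open>f\<^sub>i\<^sub>+\<^sub>1 v\<close> whenever \<open>u\<close> is adjacent or
  equal to \<open>v\<close>. If all vertices are maximal, each \<open>f\<^sub>i\<close> moves every vertex to one with the same
  neighbourhood. As the last map is constant, all neighbourhoods coincide, which makes the graph
  complete; the fixed point set then deforms to the barycentre of the simplex.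
\<close>

section \<open>Deforming a graph to a vertex\<close>

text \<open>
  A graph is described by its vertex set and the relation "adjacent or equal". With this reflexive
  relation, a map that is contiguous to itself is a graph homomorphism that may collapse edges.
\<close>

definition contiguous ::
    "'a set \<Rightarrow> 'a set \<Rightarrow> ('a \<Rightarrow> 'a \<Rightarrow> bool) \<Rightarrow> ('a \<Rightarrow> 'a) \<Rightarrow> ('a \<Rightarrow> 'a) \<Rightarrow> bool" where
  "contiguous V W E f g \<longleftrightarrow>
     (\<forall>u\<in>V. \<forall>v\<in>V. E u v \<longrightarrow> f u \<in> W \<and> g v \<in> W \<and> E (f u) (g v))"

definition graph_contractible :: "'a set \<Rightarrow> ('a \<Rightarrow> 'a \<Rightarrow> bool) \<Rightarrow> bool" where
  "graph_contractible W E \<longleftrightarrow> (\<exists>c\<in>W. (contiguous W W E)\<^sup>*\<^sup>* id (\<lambda>_. c))"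

lemma contiguous_chain_compose_right:
  assumes "contiguous V W E r r" and "W \<subseteq> V" and "(contiguous W W E)\<^sup>*\<^sup>* f g"
  shows "(contiguous V V E)\<^sup>*\<^sup>* (f \<circ> r) (g \<circ> r)"
  using assms(3)
proof induction
  case (step g h)
  have "contiguous V V E (g \<circ> r) (h \<circ> r)"
    using assms(1,2) step(2) unfolding contiguous_def comp_def by blast
  then show ?case using step(3) by (meson rtranclp.rtrancl_into_rtrancl)
qed simp

lemma contiguous_chain_compose_left:
  assumes "contiguous V W E r r" and "W \<subseteq> V" and "(contiguous V V E)\<^sup>*\<^sup>* f g"
  shows "(contiguous W W E)\<^sup>*\<^sup>* (r \<circ> f) (r \<circ> g)"
  using assms(3)
proof induction
  case (step g h)
  have "contiguous W W E (r \<circ> g) (r \<circ> h)"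
    using assms(1,2) step(2) unfolding contiguous_def comp_def by blast
  then show ?case using step(3) by (meson rtranclp.rtrancl_into_rtrancl)
qed simp

text \<open>
  Folding a dominated vertex onto a dominating one is contiguous to the identity, so it can be
  prepended to a deformation of the smaller graph.
\<close>

lemma graph_contractible_insert:
  assumes E: "\<And>u v. u \<in> insert a W \<Longrightarrow> v \<in> insert a W \<Longrightarrow> E u v \<Longrightarrow> E v u"
    and refl: "\<And>u. u \<in> insert a W \<Longrightarrow> E u u"
    and p: "p \<in> W" and dom: "\<And>z. z \<in> insert a W \<Longrightarrow> E a z \<Longrightarrow> E p z"
    and W: "graph_contractible W E"
  shows "graph_contractible (insert a W) E"
proof -
  let ?V = "insert a W" and ?r = "id(a := p)"
  obtain c where c: "c \<in> W" "(contiguous W W E)\<^sup>*\<^sup>* id (\<lambda>_. c)"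
    using W by (auto simp: graph_contractible_def)
  have fold_adj: "E u (?r v)" "E (?r u) (?r v)" if uv: "u \<in> ?V" "v \<in> ?V" "E u v" for u v
  proof -
    show *: "E u (?r v)"
      using E[of u v] E[of p u] dom[of u] uv p by auto
    show "E (?r u) (?r v)"
      using * dom[of "?r v"] uv p by auto
  qed
  have "contiguous ?V ?V E id ?r" and r: "contiguous ?V W E ?r ?r"
    using fold_adj p by (auto simp: contiguous_def)
  moreover have "(contiguous ?V ?V E)\<^sup>*\<^sup>* ?r (\<lambda>_. c)"
    using contiguous_chain_compose_right[OF r subset_insertI c(2)]
    by (simp only: id_comp K_record_comp)
  ultimately have "(contiguous ?V ?V E)\<^sup>*\<^sup>* id (\<lambda>_. c)"
    by (meson converse_rtranclp_into_rtranclp)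
  then show ?thesis using c by (auto simp: graph_contractible_def)
qed

lemma neighbourhood_induce_subgraph:
  assumes "wf_digraph G" and "u \<in> S" and "S \<subseteq> verts G"
  shows "neighbourhood (G \<restriction> S) u = neighbourhood G u \<inter> S"
  using assms
  by (auto simp: neighbourhood_def induce_subgraph_def arcs_ends_def arc_to_ends_def)

lemma neighbourhood_sym:
  assumes "graph G"
  shows "v \<in> neighbourhood G u \<longleftrightarrow> u \<in> neighbourhood G v"
  using sym_digraph.graph_symmetric[of G] assms
  by (auto simp: neighbourhood_def graph_def digraph_def pseudo_graph_def)

lemma graph_contractible_dismantling:
  assumes G: "graph G" and "\<sigma> \<noteq> []" and "distinct \<sigma>" and "set \<sigma> \<subseteq> verts G"
    and "\<And>i. Suc i < length \<sigma> \<Longrightarrow>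
           \<exists>\<pi>. dominated_by (G \<restriction> set (drop i \<sigma>)) (\<sigma> ! i) \<pi>"
  shows "graph_contractible (set \<sigma>) (\<lambda>u v. v \<in> neighbourhood G u)"
  using assms(2-)
proof (induction \<sigma>)
  case (Cons a \<sigma>)
  show ?case
  proof (cases "\<sigma> = []")
    case True
    then have "contiguous {a} {a} (\<lambda>u v. v \<in> neighbourhood G u) id (\<lambda>_. a)"
      by (auto simp: contiguous_def)
    then show ?thesis using True by (auto simp: graph_contractible_def)
  next
    case False
    have wf: "wf_digraph G"
      using G by (auto simp: graph_def digraph_def fin_digraph_def)
    have "\<exists>\<pi>. dominated_by (G \<restriction> set (drop i \<sigma>)) (\<sigma> ! i) \<pi>" if "Suc i < length \<sigma>" for i
      using Cons.prems(4)[of "Suc i"] that by simp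
    then have IH: "graph_contractible (set \<sigma>) (\<lambda>u v. v \<in> neighbourhood G u)"
      using Cons.IH False Cons.prems by simp
    obtain p where p: "dominated_by (G \<restriction> set (a # \<sigma>)) a p"
      using Cons.prems(4)[of 0] False by auto
    then have pV: "p \<in> set \<sigma>"
      by (auto simp: dominated_by_def)
    have sub: "neighbourhood G a \<inter> set (a # \<sigma>) \<subseteq> neighbourhood G p"
      using p pV Cons.prems(3) neighbourhood_induce_subgraph[OF wf, of a "set (a # \<sigma>)"]
        neighbourhood_induce_subgraph[OF wf, of p "set (a # \<sigma>)"]
      by (auto simp: dominated_by_def)
    show ?thesis
      unfolding list.set
    proof (rule graph_contractible_insert[OF _ _ pV _ IH])
      show "u \<in> neighbourhood G v" if "v \<in> neighbourhood G u" for u v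
        using that neighbourhood_sym[OF G] by blast
      show "u \<in> neighbourhood G u" for u
        by (simp add: neighbourhood_def)
      show "z \<in> neighbourhood G p" if "z \<in> insert a (set \<sigma>)" "z \<in> neighbourhood G a" for z
        using that sub by auto
    qed
  qed
qed simp


section \<open>Maximal neighbourhoods\<close>

locale reflexive_graph =
  fixes W :: "'a set" and E :: "'a \<Rightarrow> 'a \<Rightarrow> bool"
  assumes finite_vertices: "finite W"
    and adj_refl: "u \<in> W \<Longrightarrow> E u u"
    and adj_sym: "u \<in> W \<Longrightarrow> v \<in> W \<Longrightarrow> E u v \<Longrightarrow> E v u"
begin

definition nbhd_le :: "'a \<Rightarrow> 'a \<Rightarrow> bool" where
  "nbhd_le u v \<longleftrightarrow> (\<forall>z\<in>W. E z u \<longrightarrow> E z v)"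

definition maximal_vertices :: "'a set" where
  "maximal_vertices = {v \<in> W. \<forall>u\<in>W. nbhd_le v u \<longrightarrow> nbhd_le u v}"

definition dominators :: "'a \<Rightarrow> 'a set" where
  "dominators u = {v \<in> maximal_vertices. nbhd_le u v}"

lemma nbhd_le_refl: "nbhd_le u u"
  by (simp add: nbhd_le_def)

lemma nbhd_le_trans: "nbhd_le u v \<Longrightarrow> nbhd_le v w \<Longrightarrow> nbhd_le u w"
  by (simp add: nbhd_le_def)

lemma maximal_subset: "maximal_vertices \<subseteq> W"
  by (auto simp: maximal_vertices_def)

lemma dominators_subset: "dominators u \<subseteq> maximal_vertices"
  by (auto simp: dominators_def)

lemma finite_dominators: "finite (dominators u)"
  using dominators_subset maximal_subset finite_vertices by (meson finite_subset)

lemma dominators_nonempty: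
  assumes "u \<in> W"
  shows "dominators u \<noteq> {}"
proof -
  \<comment> \<open>Among the vertices above \<open>u\<close>, one with the largest neighbourhood is maximal.\<close>
  let ?N = "\<lambda>v. {z \<in> W. E z v}"
  have "\<exists>v. (v \<in> W \<and> nbhd_le u v) \<and> (\<forall>w. w \<in> W \<and> nbhd_le u w \<longrightarrow> card (?N w) \<le> card (?N v))"
  proof (rule ex_has_greatest_nat)
    show "u \<in> W \<and> nbhd_le u u" using assms nbhd_le_refl by simp
    show "\<forall>w. w \<in> W \<and> nbhd_le u w \<longrightarrow> card (?N w) < Suc (card W)"
      using finite_vertices by (auto simp: less_Suc_eq_le intro: card_mono)
  qed
  then obtain v where v: "v \<in> W" "nbhd_le u v"
    and max: "\<And>w. w \<in> W \<Longrightarrow> nbhd_le u w \<Longrightarrow> card (?N w) \<le> card (?N v)"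
    by blast
  have "nbhd_le w v" if w: "w \<in> W" "nbhd_le v w" for w
  proof -
    have "?N v \<subseteq> ?N w" using w by (auto simp: nbhd_le_def)
    moreover have "card (?N w) \<le> card (?N v)"
      using max w v nbhd_le_trans by blast
    ultimately have "?N v = ?N w"
      using finite_vertices by (intro card_seteq) auto
    then show ?thesis by (auto simp: nbhd_le_def)
  qed
  then have "v \<in> dominators u"
    using v by (auto simp: dominators_def maximal_vertices_def)
  then show ?thesis by blast
qed

text \<open>
  A vertex above \<open>v\<close> is adjacent to the neighbour \<open>u\<close> of \<open>v\<close>; as a neighbour of \<open>u\<close> it is then
  adjacent to everything above \<open>u\<close>.
\<close>

lemma dominators_adjacent:
  assumes "u \<in> W" "v \<in> W" "E u v" and b: "b \<in> dominators v"
  shows "E u b" and "a \<in> dominators u \<Longrightarrow> E a b"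
proof -
  have bW: "b \<in> W" using b dominators_subset maximal_subset by blast
  show ub: "E u b" using assms by (simp add: dominators_def nbhd_le_def)
  then have bu: "E b u" using adj_sym bW assms by blast
  show "E a b" if a: "a \<in> dominators u"
  proof -
    have "a \<in> W" using a dominators_subset maximal_subset by blast
    moreover have "E b a" using a bu bW by (simp add: dominators_def nbhd_le_def)
    ultimately show ?thesis using adj_sym bW by blast
  qed
qed

lemma graph_contractible_maximal:
  assumes "graph_contractible W E"
  shows "graph_contractible maximal_vertices E"
proof -
  let ?M = maximal_vertices
  obtain c where c: "c \<in> W" "(contiguous W W E)\<^sup>*\<^sup>* id (\<lambda>_. c)"
    using assms by (auto simp: graph_contractible_def)
  have "\<forall>u\<in>W. \<exists>v. v \<in> dominators u"
    using dominators_nonempty by blast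
  then obtain r where r: "\<And>u. u \<in> W \<Longrightarrow> r u \<in> dominators u"
    by metis
  have rM: "r u \<in> ?M" if "u \<in> W" for u
    using r[OF that] dominators_subset by blast
  have hom: "contiguous W ?M E r r"
    unfolding contiguous_def using dominators_adjacent(2)[OF _ _ _ r r] rM by blast
  have "contiguous ?M ?M E id r"
    unfolding contiguous_def id_apply using dominators_adjacent(1)[OF _ _ _ r] rM maximal_subset by blast
  moreover have "(contiguous ?M ?M E)\<^sup>*\<^sup>* r (\<lambda>_. r c)"
    using contiguous_chain_compose_left[OF hom maximal_subset c(2)] by (simp add: comp_def)
  ultimately have "(contiguous ?M ?M E)\<^sup>*\<^sup>* id (\<lambda>_. r c)"
    by (meson converse_rtranclp_into_rtranclp)
  then show ?thesis
    using rM c by (auto simp: graph_contractible_def)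
qed

text \<open>
  A map contiguous to one that preserves neighbourhoods sends each vertex to one above it; by
  maximality it preserves neighbourhoods too. Along a chain from the identity this reaches the
  constant map.
\<close>

lemma complete_if_all_maximal:
  assumes "graph_contractible W E" and all: "maximal_vertices = W" and "u \<in> W" "v \<in> W"
  shows "E u v"
proof -
  obtain c where c: "c \<in> W" "(contiguous W W E)\<^sup>*\<^sup>* id (\<lambda>_. c)"
    using assms(1) by (auto simp: graph_contractible_def)
  have "\<forall>w\<in>W. g w \<in> W \<and> nbhd_le w (g w) \<and> nbhd_le (g w) w"
    if "(contiguous W W E)\<^sup>*\<^sup>* id g" for g
    using that
  proof induction
    case (step g h)
    show ?case
    proof
      fix w assume w: "w \<in> W"
      have hW: "h w \<in> W"
        using step(2) w adj_refl by (auto simp: contiguous_def)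
      have "E z (h w)" if z: "z \<in> W" "E z w" for z
      proof -
        have "g z \<in> W" "E (g z) (h w)"
          using step(2) z w by (auto simp: contiguous_def)
        then have "E (h w) (g z)" using adj_sym hW by blast
        moreover have "nbhd_le (g z) z" using step(3) z by blast
        ultimately have "E (h w) z" using hW unfolding nbhd_le_def by blast
        then show ?thesis using adj_sym hW z by blast
      qed
      then have "nbhd_le w (h w)" by (simp add: nbhd_le_def)
      moreover have "w \<in> maximal_vertices" using w all by simp
      ultimately show "h w \<in> W \<and> nbhd_le w (h w) \<and> nbhd_le (h w) w"
        using hW unfolding maximal_vertices_def by blast
    qed
  qed (simp add: nbhd_le_refl)
  from this[OF c(2)] have "nbhd_le u c" "nbhd_le c v"
    using assms by auto
  then show ?thesis
    using adj_refl[OF \<open>u \<in> W\<close>] \<open>u \<in> W\<close> unfolding nbhd_le_def by blast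
qed

end


section \<open>The equivariant deformation\<close>

text \<open>
  These are the points of the flag complex that are fixed by \<open>H\<close>, in barycentric coordinates; the
  condition on \<open>x u\<close> and \<open>x v\<close> says that the support is a clique.
\<close>

definition invariant_points ::
    "'a set \<Rightarrow> ('a \<Rightarrow> 'a \<Rightarrow> bool) \<Rightarrow> ('a \<Rightarrow> 'a) set \<Rightarrow> ('a \<Rightarrow> real) set" where
  "invariant_points W E H =
     {x. (\<forall>v. 0 \<le> x v) \<and> (\<forall>v. v \<notin> W \<longrightarrow> x v = 0) \<and> (\<forall>u v. x u \<noteq> 0 \<longrightarrow> x v \<noteq> 0 \<longrightarrow> E u v) \<and>
         sum x W = 1 \<and> (\<forall>h\<in>H. \<forall>v\<in>W. x (h v) = x v)}"

locale graph_action = reflexive_graph +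
  fixes H :: "('a \<Rightarrow> 'a) set"
  assumes action_image: "h \<in> H \<Longrightarrow> h ` W = W"
    and action_adj: "h \<in> H \<Longrightarrow> u \<in> W \<Longrightarrow> v \<in> W \<Longrightarrow> E (h u) (h v) \<longleftrightarrow> E u v"
begin

lemma action_inj: "h \<in> H \<Longrightarrow> inj_on h W"
  using action_image finite_vertices by (metis eq_card_imp_inj_on)

lemma action_mem: "h \<in> H \<Longrightarrow> v \<in> W \<Longrightarrow> h v \<in> W"
  using action_image by blast

lemma action_nbhd_le:
  assumes "h \<in> H" "u \<in> W" "v \<in> W"
  shows "nbhd_le (h u) (h v) \<longleftrightarrow> nbhd_le u v"
proof -
  have "nbhd_le (h u) (h v) \<longleftrightarrow> (\<forall>z \<in> h ` W. E z (h u) \<longrightarrow> E z (h v))"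
    using action_image[OF assms(1)] by (simp add: nbhd_le_def)
  also have "\<dots> \<longleftrightarrow> nbhd_le u v"
    using assms by (simp add: action_adj nbhd_le_def)
  finally show ?thesis .
qed

lemma action_maximal_iff:
  assumes h: "h \<in> H" and v: "v \<in> W"
  shows "h v \<in> maximal_vertices \<longleftrightarrow> v \<in> maximal_vertices"
proof -
  have "h v \<in> maximal_vertices \<longleftrightarrow> (\<forall>u \<in> h ` W. nbhd_le (h v) u \<longrightarrow> nbhd_le u (h v))"
    using action_image[OF h] action_mem[OF h v] by (simp add: maximal_vertices_def)
  also have "\<dots> \<longleftrightarrow> v \<in> maximal_vertices"
    using h v by (simp add: action_nbhd_le maximal_vertices_def)
  finally show ?thesis .
qed

lemma action_dominators_iff:
  assumes "h \<in> H" "u \<in> W" "v \<in> W"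
  shows "h v \<in> dominators (h u) \<longleftrightarrow> v \<in> dominators u"
  using assms by (simp add: dominators_def action_maximal_iff action_nbhd_le)

lemma card_dominators_action:
  assumes h: "h \<in> H" and u: "u \<in> W"
  shows "card (dominators (h u)) = card (dominators u)"
proof -
  have DW: "dominators w \<subseteq> W" for w
    using dominators_subset maximal_subset by blast
  have "dominators (h u) = h ` dominators u"
  proof (intro equalityI subsetI)
    fix b assume b: "b \<in> dominators (h u)"
    then obtain a where "a \<in> W" "b = h a" using DW action_image[OF h] by blast
    then show "b \<in> h ` dominators u" using b action_dominators_iff[OF h u] by blast
  next
    fix b assume "b \<in> h ` dominators u"
    then show "b \<in> dominators (h u)" using action_dominators_iff[OF h u] DW by blast
  qed
  moreover have "inj_on h (dominators u)"
    using action_inj[OF h] DW by (rule inj_on_subset)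
  ultimately show ?thesis by (simp add: card_image)
qed

lemma graph_action_maximal: "graph_action maximal_vertices E H"
proof
  show "finite maximal_vertices"
    using finite_vertices maximal_subset by (rule rev_finite_subset)
  show "h ` maximal_vertices = maximal_vertices" if h: "h \<in> H" for h
  proof (intro equalityI subsetI)
    fix b assume "b \<in> h ` maximal_vertices"
    then show "b \<in> maximal_vertices" using action_maximal_iff[OF h] maximal_subset by blast
  next
    fix b assume b: "b \<in> maximal_vertices"
    then obtain a where "a \<in> W" "b = h a" using maximal_subset action_image[OF h] by blast
    then show "b \<in> h ` maximal_vertices" using b action_maximal_iff[OF h] by blast
  qed
next
  show "E u u" if "u \<in> maximal_vertices" for u
    using that adj_refl maximal_subset by blast
  show "E v u" if "u \<in> maximal_vertices" "v \<in> maximal_vertices" "E u v" for u v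
    using that adj_sym maximal_subset by blast
  show "E (h u) (h v) \<longleftrightarrow> E u v"
    if "h \<in> H" "u \<in> maximal_vertices" "v \<in> maximal_vertices" for h u v
    using that action_adj maximal_subset by blast
qed

definition barycentre :: "'a \<Rightarrow> 'a \<Rightarrow> real" where
  "barycentre v w = (if w \<in> dominators v then 1 / card (dominators v) else 0)"

text \<open>The affine extension of \<open>barycentre\<close> to the realisation.\<close>

definition push :: "('a \<Rightarrow> real) \<Rightarrow> 'a \<Rightarrow> real" where
  "push x w = (\<Sum>v\<in>W. x v * barycentre v w)"

lemma sum_barycentre:
  assumes "v \<in> W" and "dominators v \<subseteq> S" and "finite S"
  shows "sum (barycentre v) S = 1"
proof -
  have "sum (barycentre v) S = sum (barycentre v) (dominators v)"
    using assms by (intro sum.mono_neutral_right) (auto simp: barycentre_def)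
  also have "\<dots> = 1"
    using finite_dominators[of v] dominators_nonempty[OF assms(1)]
    by (simp add: barycentre_def)
  finally show ?thesis .
qed

lemma sum_push:
  assumes "maximal_vertices \<subseteq> S" and "finite S"
  shows "sum (push x) S = sum x W"
proof -
  have "sum (push x) S = (\<Sum>v\<in>W. x v * sum (barycentre v) S)"
    unfolding push_def by (subst sum.swap) (simp add: sum_distrib_left)
  also have "\<dots> = sum x W"
  proof (rule sum.cong)
    show "x v * sum (barycentre v) S = x v" if "v \<in> W" for v
      using sum_barycentre[OF that, of S] dominators_subset[of v] assms by auto
  qed simp
  finally show ?thesis .
qed

lemma push_invariant:
  assumes h: "h \<in> H" and w: "w \<in> W" and x: "\<And>v. v \<in> W \<Longrightarrow> x (h v) = x v"
  shows "push x (h w) = push x w"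
proof -
  have "push x (h w) = (\<Sum>v \<in> h ` W. x v * barycentre v (h w))"
    using action_image[OF h] by (simp add: push_def)
  also have "\<dots> = (\<Sum>v\<in>W. x (h v) * barycentre (h v) (h w))"
    by (rule sum.reindex_cong[OF action_inj[OF h] refl refl])
  also have "\<dots> = push x w"
    unfolding push_def using h w x
    by (intro sum.cong) (simp_all add: barycentre_def action_dominators_iff card_dominators_action)
  finally show ?thesis .
qed

lemma push_nonneg: "(\<And>v. 0 \<le> x v) \<Longrightarrow> 0 \<le> push x w"
  by (auto simp: push_def barycentre_def intro!: sum_nonneg)

lemma push_support:
  assumes "push x w \<noteq> 0"
  obtains v where "v \<in> W" "x v \<noteq> 0" "w \<in> dominators v"
proof -
  obtain v where "v \<in> W" "x v * barycentre v w \<noteq> 0"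
    using assms unfolding push_def by (rule sum.not_neutral_contains_not_neutral)
  then show thesis
    using that[of v] by (simp add: barycentre_def split: if_splits)
qed

lemma push_support_maximal: "push x w \<noteq> 0 \<Longrightarrow> w \<in> maximal_vertices"
  using push_support dominators_subset by blast

lemma invariant_pointsD:
  assumes "x \<in> invariant_points W E H"
  shows "0 \<le> x v" and "x v \<noteq> 0 \<Longrightarrow> v \<in> W" and "x u \<noteq> 0 \<Longrightarrow> x v \<noteq> 0 \<Longrightarrow> E u v"
    and "sum x W = 1" and "h \<in> H \<Longrightarrow> v \<in> W \<Longrightarrow> x (h v) = x v"
  using assms by (auto simp: invariant_points_def)

text \<open>
  In other words, a point and its image lie in a common simplex; this is what makes the straight
  line between them available.
\<close>

lemma push_support_adjacent:
  assumes x: "x \<in> invariant_points W E H" and u: "x u \<noteq> 0 \<or> push x u \<noteq> 0"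
    and v: "x v \<noteq> 0 \<or> push x v \<noteq> 0"
  shows "E u v"
proof -
  note xD = invariant_pointsD[OF x]
  have dW: "b \<in> W" if "b \<in> dominators a" for a b
    using that dominators_subset maximal_subset by blast
  have 1: "E a b" if a: "x a \<noteq> 0" and b: "push x b \<noteq> 0" for a b
    using b
  proof (rule push_support)
    fix b' assume "b' \<in> W" "x b' \<noteq> 0" "b \<in> dominators b'"
    then show "E a b" using dominators_adjacent(1) xD a by blast
  qed
  have 2: "E b a" if a: "x a \<noteq> 0" and b: "push x b \<noteq> 0" for a b
  proof -
    obtain b' where "b \<in> dominators b'" using push_support[OF b] by blast
    then show ?thesis using adj_sym[OF xD(2)[OF a] dW] 1[OF that] by blast
  qed
  have 3: "E a b" if a: "push x a \<noteq> 0" and b: "push x b \<noteq> 0" for a b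
    using a
  proof (rule push_support)
    fix a' assume a': "a' \<in> W" "x a' \<noteq> 0" "a \<in> dominators a'"
    from b show "E a b"
    proof (rule push_support)
      fix b' assume "b' \<in> W" "x b' \<noteq> 0" "b \<in> dominators b'"
      then show "E a b" using dominators_adjacent(2) xD(3) a' by blast
    qed
  qed
  from u v show ?thesis
    by (elim disjE) (rule xD(3) 1 2 3; assumption)+
qed

lemma push_in_invariant_points_maximal:
  assumes x: "x \<in> invariant_points W E H"
  shows "push x \<in> invariant_points maximal_vertices E H"
proof -
  note xD = invariant_pointsD[OF x]
  have "push x v = 0" if "v \<notin> maximal_vertices" for v
    using that push_support_maximal by blast
  moreover have "E u v" if "push x u \<noteq> 0" "push x v \<noteq> 0" for u v
    using push_support_adjacent[OF x] that by blast
  moreover have "sum (push x) maximal_vertices = 1"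
    using sum_push[OF order_refl finite_subset[OF maximal_subset finite_vertices], of x] xD(4)
    by simp
  moreover have "push x (h v) = push x v" if "h \<in> H" "v \<in> maximal_vertices" for h v
    using push_invariant that xD(5) maximal_subset by blast
  ultimately show ?thesis
    using push_nonneg[of x, OF xD(1)] unfolding invariant_points_def by blast
qed

lemma segment_to_push:
  assumes x: "x \<in> invariant_points W E H" and t: "0 \<le> t" "t \<le> 1"
  shows "(\<lambda>v. (1 - t) * x v + t * push x v) \<in> invariant_points W E H"
proof -
  note xD = invariant_pointsD[OF x]
  have supp: "x v \<noteq> 0 \<or> push x v \<noteq> 0" if "(1 - t) * x v + t * push x v \<noteq> 0" for v
    using that by auto
  have "0 \<le> (1 - t) * x v + t * push x v" for v
    using t xD(1) push_nonneg[of x] by simp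
  moreover have "v \<in> W" if "(1 - t) * x v + t * push x v \<noteq> 0" for v
    using supp[OF that] xD(2) push_support_maximal maximal_subset by blast
  moreover have "E u v"
    if "(1 - t) * x u + t * push x u \<noteq> 0" "(1 - t) * x v + t * push x v \<noteq> 0" for u v
    using push_support_adjacent[OF x] supp that by blast
  moreover have "(\<Sum>v\<in>W. (1 - t) * x v + t * push x v) = 1"
    using sum_push[OF maximal_subset finite_vertices, of x] xD(4)
    by (simp add: sum.distrib flip: sum_distrib_left)
  moreover have "(1 - t) * x (h v) + t * push x (h v) = (1 - t) * x v + t * push x v"
    if "h \<in> H" "v \<in> W" for h v
    using push_invariant[OF that] xD(5) that by simp
  ultimately show ?thesis
    unfolding invariant_points_def by blast
qed

lemma continuous_on_push: "continuous_on S push"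
proof (rule continuous_on_coordinatewise_then_product)
  show "continuous_on S (\<lambda>x. push x w)" for w
    unfolding push_def
    by (intro continuous_intros continuous_on_subset[OF continuous_on_product_coordinates]) auto
qed

lemma homotopic_id_push:
  "homotopic_with_canon (\<lambda>_. True) (invariant_points W E H) (invariant_points W E H) id push"
proof -
  let ?F = "invariant_points W E H"
  let ?h = "\<lambda>(t, x). \<lambda>v. (1 - t) * x v + t * push x v"
  have "continuous_on ({0..1} \<times> ?F) ?h"
  proof (rule continuous_on_coordinatewise_then_product)
    fix v
    have coord: "continuous_on ({0..1} \<times> ?F) (\<lambda>p. snd p v)"
      by (rule continuous_on_product_then_coordinatewise) (intro continuous_intros)
    have "continuous_on ({0..1} \<times> ?F) (\<lambda>p. push (snd p))"
      by (rule continuous_on_compose2[OF continuous_on_push[of UNIV]])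
        (auto intro: continuous_intros)
    then have "continuous_on ({0..1} \<times> ?F) (\<lambda>p. push (snd p) v)"
      by (rule continuous_on_product_then_coordinatewise)
    with coord show "continuous_on ({0..1} \<times> ?F) (\<lambda>p. ?h p v)"
      unfolding case_prod_beta by (intro continuous_intros)
  qed
  moreover have "?h \<in> {0..1} \<times> ?F \<rightarrow> ?F"
    by (auto simp: segment_to_push)
  ultimately have "continuous_map (prod_topology (top_of_set {0..1}) (top_of_set ?F))
      (top_of_set ?F) ?h"
    by (simp flip: subtopology_Times)
  then show ?thesis
    unfolding homotopic_with_def
    by (intro exI[of _ ?h]) auto
qed

lemma invariant_points_maximal_subset:
  "invariant_points maximal_vertices E H \<subseteq> invariant_points W E H"
proof
  fix x assume x: "x \<in> invariant_points maximal_vertices E H"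
  have out: "x v = 0" if "v \<notin> maximal_vertices" for v
    using x that by (simp add: invariant_points_def)
  have "sum x W = sum x maximal_vertices"
    using out finite_vertices maximal_subset by (intro sum.mono_neutral_right) auto
  moreover have "x (h v) = x v" if "h \<in> H" "v \<in> W" for h v
  proof (cases "v \<in> maximal_vertices")
    case True
    then show ?thesis using x that by (simp add: invariant_points_def)
  next
    case False
    then show ?thesis using out action_maximal_iff[OF that] by simp
  qed
  ultimately show "x \<in> invariant_points W E H"
    using x maximal_subset unfolding invariant_points_def by auto
qed

text \<open>
  In a complete graph every vertex dominates every other, so \<open>push\<close> is constant and the homotopy
  \<open>homotopic_id_push\<close> is already a contraction.
\<close>

lemma complete_case:
  assumes "W \<noteq> {}" and complete: "\<And>u v. u \<in> W \<Longrightarrow> v \<in> W \<Longrightarrow> E u v"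
  shows "invariant_points W E H \<noteq> {} \<and> contractible (invariant_points W E H)"
proof -
  define b :: "'a \<Rightarrow> real" where "b = (\<lambda>w. if w \<in> W then 1 / card W else 0)"
  have b: "b \<in> invariant_points W E H"
    using assms finite_vertices action_mem by (auto simp: b_def invariant_points_def)
  have "dominators v = W" for v
    using complete by (auto simp: dominators_def maximal_vertices_def nbhd_le_def)
  then have "push x = b" if "x \<in> invariant_points W E H" for x
    using invariant_pointsD(4)[OF that]
    by (auto simp: push_def barycentre_def b_def simp flip: sum_divide_distrib)
  then have "homotopic_with_canon (\<lambda>_. True) (invariant_points W E H) (invariant_points W E H)
      id (\<lambda>_. b)"
    by (intro homotopic_with_eq[OF homotopic_id_push]) auto
  then show ?thesis
    using b by (auto simp: contractible_def)
qed

text \<open>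
  The identity is homotopic to a map that factors through the fixed points supported on the maximal
  vertices.
\<close>

lemma contractible_from_maximal:
  assumes "contractible (invariant_points maximal_vertices E H)"
  shows "contractible (invariant_points W E H)"
proof -
  obtain c where "homotopic_with_canon (\<lambda>_. True) (invariant_points W E H)
      (invariant_points maximal_vertices E H) push (\<lambda>_. c)"
    using nullhomotopic_into_contractible[OF continuous_on_push _ assms]
      push_in_invariant_points_maximal by blast
  then have "homotopic_with_canon (\<lambda>_. True) (invariant_points W E H)
      (invariant_points W E H) push (\<lambda>_. c)"
    using invariant_points_maximal_subset by (rule homotopic_with_subset_right)
  with homotopic_id_push show ?thesis
    unfolding contractible_def by (blast intro: homotopic_with_trans)
qed

end

lemma invariant_points_contractible:
  assumes "graph_action W E H" and "graph_contractible W E"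
  shows "invariant_points W E H \<noteq> {} \<and> contractible (invariant_points W E H)"
  using assms
proof (induction "card W" arbitrary: W rule: less_induct)
  case less
  interpret graph_action W E H by fact
  show ?case
  proof (cases "maximal_vertices = W")
    case True
    have "W \<noteq> {}"
      using less.prems(2) by (auto simp: graph_contractible_def)
    then show ?thesis
      using complete_if_all_maximal[OF less.prems(2) True] complete_case by blast
  next
    case False
    then have "card maximal_vertices < card W"
      using maximal_subset finite_vertices by (intro psubset_card_mono) auto
    then have "invariant_points maximal_vertices E H \<noteq> {} \<and>
        contractible (invariant_points maximal_vertices E H)"
      using less.hyps graph_action_maximal graph_contractible_maximal[OF less.prems(2)] by blast
    then show ?thesis
      using contractible_from_maximal invariant_points_maximal_subset by blast
  qed
qed


section \<open>Fixed points of the flag complex\<close>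

lemma Union_flag_complex: "\<Union>(flag_complex G) = verts G"
proof
  show "verts G \<subseteq> \<Union>(flag_complex G)"
  proof
    fix v assume "v \<in> verts G"
    then have "{v} \<in> flag_complex G" by (auto simp: flag_complex_def clique_def)
    then show "v \<in> \<Union>(flag_complex G)" by blast
  qed
qed (auto simp: flag_complex_def clique_def)

lemma edge_in_flag_complex_iff:
  assumes "graph G" and "u \<in> verts G" "v \<in> verts G"
  shows "{u, v} \<in> flag_complex G \<longleftrightarrow> v \<in> neighbourhood G u"
  using assms neighbourhood_sym[OF assms(1), of u v]
  by (auto simp: flag_complex_def clique_def neighbourhood_def)

lemma graph_action_flag_complex:
  assumes G: "graph G" and H: "H \<subseteq> carrier (Aut (flag_complex G))"
  shows "graph_action (verts G) (\<lambda>u v. v \<in> neighbourhood G u) H"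
proof
  show "finite (verts G)"
    using G by (simp add: graph_def digraph_def fin_digraph_def fin_digraph_axioms_def)
  show "u \<in> neighbourhood G u" for u
    by (simp add: neighbourhood_def)
  show "u \<in> neighbourhood G v" if "v \<in> neighbourhood G u" for u v
    using that neighbourhood_sym[OF G] by blast
next
  fix h assume "h \<in> H"
  then have h: "bij_betw h (verts G) (verts G)" "simplicial_map (flag_complex G) (flag_complex G) h"
    "simplicial_map (flag_complex G) (flag_complex G) (inv_into (verts G) h)"
    using H by (auto simp: Aut_def simplicial_automorphisms_def Union_flag_complex Bij_def)
  then show "h ` verts G = verts G"
    by (simp add: bij_betw_def)
  fix u v assume uv: "u \<in> verts G" "v \<in> verts G"
  have huv: "h u \<in> verts G" "h v \<in> verts G"
    using h(1) uv by (auto simp: bij_betw_def)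
  have "inv_into (verts G) h ` {h u, h v} = {u, v}"
    using uv h(1) by (simp add: bij_betw_inv_into_left)
  moreover have "h ` {u, v} = {h u, h v}"
    by simp
  ultimately have "{h u, h v} \<in> flag_complex G \<longleftrightarrow> {u, v} \<in> flag_complex G"
    using h(2,3) unfolding simplicial_map_def by metis
  then show "h v \<in> neighbourhood G (h u) \<longleftrightarrow> v \<in> neighbourhood G u"
    using edge_in_flag_complex_iff[OF G] uv huv by simp
qed

text \<open>
  For a permutation \<open>h\<close> each coordinate sum in \<open>realisation_map h\<close> has at most one term, so the
  induced map just permutes the coordinates.
\<close>

lemma realisation_map_fixed_iff:
  assumes h: "bij_betw h W W" and x: "{v. x v \<noteq> 0} \<subseteq> W"
  shows "realisation_map h x = x \<longleftrightarrow> (\<forall>v\<in>W. x (h v) = x v)"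
proof -
  have image: "realisation_map h x (h u) = x u" if u: "u \<in> W" for u
  proof -
    have "v = u" if "x v \<noteq> 0" "h v = h u" for v
      using inj_onD[OF bij_betw_imp_inj_on[OF h] that(2)] x u that(1) by blast
    then have "{v. x v \<noteq> 0 \<and> h v = h u} = (if x u \<noteq> 0 then {u} else {})"
      by auto
    then show ?thesis by (simp add: realisation_map_def)
  qed
  have outside: "realisation_map h x w = x w" if "w \<notin> W" for w
  proof -
    have "{v. x v \<noteq> 0 \<and> h v = w} = {}"
      using bij_betw_apply[OF h] x that by blast
    moreover have "x w = 0" using x that by blast
    ultimately show ?thesis by (simp only: realisation_map_def sum.empty)
  qed
  have "realisation_map h x = x \<longleftrightarrow> (\<forall>w \<in> h ` W. realisation_map h x w = x w)"
    using outside h unfolding bij_betw_def fun_eq_iff by metis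
  moreover have "realisation_map h x (h v) = x (h v) \<longleftrightarrow> x (h v) = x v" if "v \<in> W" for v
    using image[OF that] by argo
  ultimately show ?thesis by simp
qed

lemma fixed_points_flag_complex:
  assumes G: "graph G" and H: "H \<subseteq> carrier (Aut (flag_complex G))"
  shows "fixed_points (flag_complex G) H =
    invariant_points (verts G) (\<lambda>u v. v \<in> neighbourhood G u) H"
proof -
  interpret graph_action "verts G" "\<lambda>u v. v \<in> neighbourhood G u" H
    using assms by (rule graph_action_flag_complex)
  have bij: "bij_betw h (verts G) (verts G)" if "h \<in> H" for h
    using that action_inj action_image by (simp add: bij_betw_def)
  have sum: "(\<Sum>v | x v \<noteq> 0. x v) = sum x (verts G)"
    if "{v. x v \<noteq> 0} \<subseteq> verts G" for x :: "'a \<Rightarrow> real"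
    using that finite_vertices by (intro sum.mono_neutral_left) auto
  \<comment> \<open>The empty set is no simplex, but it is not a support either, as coordinates add up to 1.\<close>
  have supp: "{v. x v \<noteq> 0} \<in> flag_complex G \<longleftrightarrow>
      {v. x v \<noteq> 0} \<subseteq> verts G \<and> (\<forall>u v. x u \<noteq> 0 \<longrightarrow> x v \<noteq> 0 \<longrightarrow> v \<in> neighbourhood G u)"
    if "(\<Sum>v | x v \<noteq> 0. x v) = 1" for x :: "'a \<Rightarrow> real"
  proof -
    have "{v. x v \<noteq> 0} \<noteq> {}"
      using that by (metis sum.empty zero_neq_one)
    moreover have "finite {v. x v \<noteq> 0}" if "{v. x v \<noteq> 0} \<subseteq> verts G"
      using that finite_vertices by (rule finite_subset)
    moreover have "clique G {v. x v \<noteq> 0} \<longleftrightarrow> {v. x v \<noteq> 0} \<subseteq> verts G \<and>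
        (\<forall>u v. x u \<noteq> 0 \<longrightarrow> x v \<noteq> 0 \<longrightarrow> v \<in> neighbourhood G u)"
      unfolding clique_def neighbourhood_def by (simp add: Ball_def) metis
    ultimately show ?thesis
      unfolding flag_complex_def mem_Collect_eq by metis
  qed
  show ?thesis
  proof (rule Set.set_eqI)
    fix x :: "'a \<Rightarrow> real"
    show "x \<in> fixed_points (flag_complex G) H \<longleftrightarrow>
        x \<in> invariant_points (verts G) (\<lambda>u v. v \<in> neighbourhood G u) H"
    proof (cases "{v. x v \<noteq> 0} \<subseteq> verts G")
      case True
      let ?clique = "\<forall>u v. x u \<noteq> 0 \<longrightarrow> x v \<noteq> 0 \<longrightarrow> v \<in> neighbourhood G u"
      have outside: "\<forall>v. v \<notin> verts G \<longrightarrow> x v = 0"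
        using True by blast
      have "(\<forall>h\<in>H. realisation_map h x = x) \<longleftrightarrow> (\<forall>h\<in>H. \<forall>v\<in>verts G. x (h v) = x v)"
        using realisation_map_fixed_iff[OF bij True] by (rule ball_cong[OF refl])
      moreover have "{v. x v \<noteq> 0} \<in> flag_complex G \<longleftrightarrow> ?clique" if "sum x (verts G) = 1"
        using supp[of x] that unfolding sum[OF True] by (simp only: True simp_thms)
      ultimately show ?thesis
        unfolding fixed_points_def realisation_def invariant_points_def mem_Collect_eq sum[OF True]
        using outside by argo
    next
      case False
      then have "{v. x v \<noteq> 0} \<notin> flag_complex G"
        by (simp only: flag_complex_def clique_def mem_Collect_eq simp_thms)
      moreover have "\<not> (\<forall>v. v \<notin> verts G \<longrightarrow> x v = 0)"
        using False by blast
      ultimately show ?thesis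
        unfolding fixed_points_def realisation_def invariant_points_def mem_Collect_eq by argo
    qed
  qed
qed

theorem theorem1p4:
  fixes G :: "('a, 'b) pre_digraph" and H :: "('a \<Rightarrow> 'a) set"
  assumes "graph G" and "dismantlable G"
    and "subgroup H (Aut (flag_complex G))" and "finite H"
  shows "fixed_points (flag_complex G) H \<noteq> {} \<and> contractible (fixed_points (flag_complex G) H)"
proof -
  have H: "H \<subseteq> carrier (Aut (flag_complex G))"
    using assms(3) by (rule subgroup.subset)
  obtain \<sigma> where \<sigma>: "\<sigma> \<noteq> []" "distinct \<sigma>" "set \<sigma> = verts G"
    "\<And>i. Suc i < length \<sigma> \<Longrightarrow> \<exists>\<pi>. dominated_by (G \<restriction> set (drop i \<sigma>)) (\<sigma> ! i) \<pi>"
    using assms(2) unfolding dismantlable_def by blast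
  have "graph_contractible (verts G) (\<lambda>u v. v \<in> neighbourhood G u)"
    using graph_contractible_dismantling[OF assms(1) \<sigma>(1,2) _ \<sigma>(4)] \<sigma>(3) by simp
  then show ?thesis
    using invariant_points_contractible[OF graph_action_flag_complex[OF assms(1) H]]
      fixed_points_flag_complex[OF assms(1) H] by simp
qed

end
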